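(* For every integer $n\ge 1$, the number $R_n$ of non-equivalent planar configurations with $n$ points satisfies $$1.58^{\,n-6}\le R_n\le 2^{n2^n}.$$
   Context: For $X\subseteq\mathbb{R}^2$ and $A\subseteq X$, let $\mathrm{ch}(A)$ be the convex hull of $A$ and let $\mathrm{Rch}_X(A)=\mathrm{ch}(A)\cap X$ be the relative convex hull of $A$ with respect to $X$. The relative lattice of $X$ is the set $\mathscr{R}(X)=\{\mathrm{Rch}_X(Y)\mid Y\subseteq X\}$ with operations $A\vee_R B=\mathrm{Rch}_X(A\cup B)$ and $A\wedge_R B=A\cap B$. Two sets $X,Y$ are equivalent if $\mathscr{R}(X)$ and $\mathscr{R}(Y)$ are isomorphic as lattices; a configuration is an equivalence class of this relation. $R_n$ is the number of equivalence classes of $n$-point subsets of the plane $\mathbb{R}^2$, i.e. the number of isomorphism classes of lattices $\mathscr{R}(X)$ with $X\subseteq\mathbb{R}^2$, $|X|=n$. *)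

theory Defs
  imports "HOL-Analysis.Analysis"
begin

type_synonym plane = "real ^ 2"

definition Rch :: "plane set \<Rightarrow> plane set \<Rightarrow> plane set" where
  "Rch X A = convex hull A \<inter> X"

definition rel_lattice :: "plane set \<Rightarrow> plane set set" where
  "rel_lattice X = {Rch X Y | Y. Y \<subseteq> X}"

definition rel_join :: "plane set \<Rightarrow> plane set \<Rightarrow> plane set \<Rightarrow> plane set" where
  "rel_join X A B = Rch X (A \<union> B)"

definition rel_meet :: "plane set \<Rightarrow> plane set \<Rightarrow> plane set" where
  "rel_meet A B = A \<inter> B"

definition rel_lattice_iso :: "plane set \<Rightarrow> plane set \<Rightarrow> (plane set \<Rightarrow> plane set) \<Rightarrow> bool" where
  "rel_lattice_iso X Y f \<longleftrightarrow>
     bij_betw f (rel_lattice X) (rel_lattice Y) \<and>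
     (\<forall>A\<in>rel_lattice X. \<forall>B\<in>rel_lattice X.
        f (rel_join X A B) = rel_join Y (f A) (f B) \<and>
        f (rel_meet A B) = rel_meet (f A) (f B))"

definition config_rel :: "(plane set \<times> plane set) set" where
  "config_rel = {(X, Y). \<exists>f. rel_lattice_iso X Y f}"

definition configurations :: "nat \<Rightarrow> plane set set set" where
  "configurations n = {X. finite X \<and> card X = n} // config_rel"

text \<open>
  \<^const>\<open>card\<close> is 0 on infinite sets, so a positive lower bound on \<open>num_configs n\<close>
  also asserts that there are only finitely many configurations of \<open>n\<close> points.
\<close>

definition num_configs :: "nat \<Rightarrow> nat" where
  "num_configs n = card (configurations n)"

lemma Rch_Rch:
  assumes "Y \<subseteq> X"
  shows "Rch X (Rch X Y) = Rch X Y"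
proof -
  have "Y \<subseteq> Rch X Y"
    using assms hull_subset[of Y convex] by (auto simp: Rch_def)
  moreover have "Rch X Y \<subseteq> convex hull Y"
    by (auto simp: Rch_def)
  ultimately have "convex hull (Rch X Y) = convex hull Y"
    by (metis hull_hull hull_mono subset_antisym)
  then show ?thesis
    by (simp add: Rch_def)
qed

lemma rel_join_closed:
  assumes "A \<in> rel_lattice X" "B \<in> rel_lattice X"
  shows "rel_join X A B \<in> rel_lattice X"
proof -
  have "A \<union> B \<subseteq> X"
    using assms by (auto simp: rel_lattice_def Rch_def)
  then show ?thesis
    by (auto simp: rel_join_def rel_lattice_def)
qed

lemma rel_meet_closed:
  assumes "A \<in> rel_lattice X" "B \<in> rel_lattice X"
  shows "rel_meet A B \<in> rel_lattice X"
proof -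
  have AB: "A \<subseteq> X" "B \<subseteq> X" "Rch X A = A" "Rch X B = B"
    using assms Rch_Rch by (auto simp: rel_lattice_def Rch_def)
  have "Rch X (A \<inter> B) \<subseteq> A \<inter> B"
    using AB(3,4) hull_mono[of "A \<inter> B" A convex] hull_mono[of "A \<inter> B" B convex]
    unfolding Rch_def by blast
  moreover have "A \<inter> B \<subseteq> Rch X (A \<inter> B)"
    using AB(1) hull_subset[of "A \<inter> B" convex] by (auto simp: Rch_def)
  ultimately have "Rch X (A \<inter> B) = A \<inter> B"
    by blast
  then show ?thesis
    using AB(1) unfolding rel_meet_def rel_lattice_def by blast
qed

lemma rel_lattice_iso_id: "rel_lattice_iso X X id"
  by (simp add: rel_lattice_iso_def)

lemma rel_lattice_iso_inv:
  assumes "rel_lattice_iso X Y f"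
  shows "rel_lattice_iso Y X (inv_into (rel_lattice X) f)"
proof -
  let ?g = "inv_into (rel_lattice X) f"
  have bij: "bij_betw f (rel_lattice X) (rel_lattice Y)"
    using assms by (simp add: rel_lattice_iso_def)
  have "?g (rel_join Y C D) = rel_join X (?g C) (?g D) \<and>
        ?g (rel_meet C D) = rel_meet (?g C) (?g D)"
    if "C \<in> rel_lattice Y" "D \<in> rel_lattice Y" for C D
  proof -
    have g: "?g C \<in> rel_lattice X" "?g D \<in> rel_lattice X" "f (?g C) = C" "f (?g D) = D"
      using bij that by (auto simp: bij_betw_def inv_into_into f_inv_into_f)
    have "f (rel_join X (?g C) (?g D)) = rel_join Y C D"
      "f (rel_meet (?g C) (?g D)) = rel_meet C D"
      using assms g by (auto simp: rel_lattice_iso_def)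
    then show ?thesis
      using rel_join_closed[OF g(1,2)] rel_meet_closed[OF g(1,2)] bij
      by (metis bij_betw_inv_into_left)
  qed
  then show ?thesis
    using bij_betw_inv_into[OF bij] by (simp add: rel_lattice_iso_def)
qed

lemma rel_lattice_iso_comp:
  assumes f: "rel_lattice_iso X Y f" and g: "rel_lattice_iso Y Z g"
  shows "rel_lattice_iso X Z (g \<circ> f)"
proof -
  have "f A \<in> rel_lattice Y" if "A \<in> rel_lattice X" for A
    using f that by (auto simp: rel_lattice_iso_def bij_betw_def)
  then show ?thesis
    using f g by (auto simp: rel_lattice_iso_def intro: bij_betw_trans)
qed

lemma equiv_config_rel: "equiv UNIV config_rel"
proof (rule equivI)
  show "refl config_rel"
    using rel_lattice_iso_id by (auto simp: config_rel_def refl_on_def)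
  show "sym config_rel"
    using rel_lattice_iso_inv by (auto simp: config_rel_def sym_def)
  show "trans config_rel"
    unfolding config_rel_def trans_def using rel_lattice_iso_comp by blast
qed auto

end

theory Submission
  imports Defs "HOL-Number_Theory.Fib"
begin

text \<open>
  A relative lattice is a family of subsets of its point set, and a bijection of the points that
  carries one such family to another is an isomorphism of the lattices, because join and meet are
  determined by inclusion (\<open>order_iso_imp_rel_lattice_iso\<close>).  Labelling the points by
  \<open>0, \<dots>, n - 1\<close> therefore gives at most as many configurations as there are families of subsets
  of an \<open>n\<close>-element set, that is \<open>2 ^ 2 ^ n\<close>, which is below the stated bound.

  Conversely, a lattice isomorphism permutes the atoms, which are the single points, so it comes
  from a bijection of the points (\<open>rel_lattice_iso_imp_point_bij\<close>).  The join of two atoms consists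
  of the points on the segment between them, hence everything expressed by the numbers of points on
  segments is an invariant of the configuration.  For the lower bound, consider fans: an apex, a
  base line with equidistant points \<open>p\<^sub>0, \<dots>, p\<^sub>m\<close>, and for each \<open>i\<close> in a set \<open>S\<close> the midpoint of the
  segment from the apex to \<open>p\<^sub>i\<close>.  If \<open>3 \<le> m\<close>, \<open>0 \<in> S\<close> and \<open>m \<notin> S\<close>, then the apex, \<open>p\<^sub>0\<close> and \<open>p\<^sub>m\<close> are the
  extreme points of the fan, and the three sides of this triangle carry at least four points,
  three points and two points.  Thus the three corners can be told apart, the
  index of a base point can be read off by counting the points between it and \<open>p\<^sub>0\<close>, and \<open>S\<close> is
  recovered as the set of those indices whose ray from the apex carries a third point
  (\<open>fan_readings\<close>).

  A fan has \<open>m + 2 + card S\<close> points, so each point in the interior of the base costs one point or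
  two.  The fans of a given size correspond to the compositions of a number into parts 1 and 2, so
  their number is a Fibonacci number: \<open>fib (n - 3) \<le> num_configs n\<close> for \<open>7 \<le> n\<close> (\<open>fib_le_num_configs\<close>).  Fibonacci
  numbers grow faster than powers of 1.58, since \<open>1.58\<^sup>2 \<le> 1.58 + 1\<close>.  For \<open>n \<le> 6\<close> the lower bound
  only says that some configuration exists.
\<close>

section \<open>Isomorphisms of relative lattices\<close>

lemma rel_lattice_subset: "A \<in> rel_lattice X \<Longrightarrow> A \<subseteq> X"
  by (auto simp: rel_lattice_def Rch_def)

lemma Rch_mono: "A \<subseteq> B \<Longrightarrow> Rch X A \<subseteq> Rch X B"
  unfolding Rch_def using hull_mono[of A B convex] by blast

lemma Rch_rel_lattice: "A \<in> rel_lattice X \<Longrightarrow> Rch X A = A"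
  using Rch_Rch by (auto simp: rel_lattice_def)

lemma Rch_in_rel_lattice: "A \<subseteq> X \<Longrightarrow> Rch X A \<in> rel_lattice X"
  by (auto simp: rel_lattice_def)

lemma empty_in_rel_lattice: "{} \<in> rel_lattice X"
  using Rch_in_rel_lattice[of "{}" X] by (simp add: Rch_def)

lemma singleton_in_rel_lattice: "x \<in> X \<Longrightarrow> {x} \<in> rel_lattice X"
  using Rch_in_rel_lattice[of "{x}" X] by (simp add: Rch_def)

lemma rel_join_upper:
  assumes "A \<in> rel_lattice X" "B \<in> rel_lattice X"
  shows "A \<subseteq> rel_join X A B" "B \<subseteq> rel_join X A B"
  using rel_lattice_subset[OF assms(1)] rel_lattice_subset[OF assms(2)]
    hull_subset[of "A \<union> B" convex]
  unfolding rel_join_def Rch_def by blast+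

lemma rel_join_least:
  assumes "C \<in> rel_lattice X" "A \<subseteq> C" "B \<subseteq> C"
  shows "rel_join X A B \<subseteq> C"
  using Rch_mono[of "A \<union> B" C X] Rch_rel_lattice[OF assms(1)] assms(2,3)
  by (simp add: rel_join_def)

text \<open>
  Join and meet are the least upper and the greatest lower bound with respect to inclusion.
\<close>

lemma order_iso_imp_rel_lattice_iso:
  assumes bij: "bij_betw f (rel_lattice X) (rel_lattice Y)"
    and ord: "\<And>A B. A \<in> rel_lattice X \<Longrightarrow> B \<in> rel_lattice X \<Longrightarrow> f A \<subseteq> f B \<longleftrightarrow> A \<subseteq> B"
  shows "rel_lattice_iso X Y f"
  unfolding rel_lattice_iso_def
proof (intro conjI ballI bij)
  fix A B assume A: "A \<in> rel_lattice X" and B: "B \<in> rel_lattice X"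
  have fin: "f C \<in> rel_lattice Y" if "C \<in> rel_lattice X" for C
    using bij that by (auto simp: bij_betw_def)
  have surj: "\<exists>C\<in>rel_lattice X. f C = D" if "D \<in> rel_lattice Y" for D
    using that by (metis bij bij_betw_imp_surj_on image_iff)
  note J = rel_join_closed[OF A B] and M = rel_meet_closed[OF A B]
  show "f (rel_join X A B) = rel_join Y (f A) (f B)"
  proof
    obtain C where C: "C \<in> rel_lattice X" "f C = rel_join Y (f A) (f B)"
      using surj[OF rel_join_closed[OF fin[OF A] fin[OF B]]] by blast
    have "A \<subseteq> C" "B \<subseteq> C"
      using rel_join_upper[OF fin[OF A] fin[OF B]] ord[OF A C(1)] ord[OF B C(1)] C(2) by auto
    then have "rel_join X A B \<subseteq> C"
      using rel_join_least[OF C(1)] by blast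
    then show "f (rel_join X A B) \<subseteq> rel_join Y (f A) (f B)"
      using ord[OF J C(1)] C(2) by simp
    show "rel_join Y (f A) (f B) \<subseteq> f (rel_join X A B)"
      using rel_join_least[OF fin[OF J]] ord[OF A J] ord[OF B J] rel_join_upper[OF A B] by blast
  qed
  show "f (rel_meet A B) = rel_meet (f A) (f B)"
  proof
    show "f (rel_meet A B) \<subseteq> rel_meet (f A) (f B)"
      using ord[OF M A] ord[OF M B] by (auto simp: rel_meet_def)
    obtain C where C: "C \<in> rel_lattice X" "f C = rel_meet (f A) (f B)"
      using surj[OF rel_meet_closed[OF fin[OF A] fin[OF B]]] by blast
    have "C \<subseteq> rel_meet A B"
      using ord[OF C(1) A] ord[OF C(1) B] C(2) by (auto simp: rel_meet_def)
    then show "rel_meet (f A) (f B) \<subseteq> f (rel_meet A B)"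
      using ord[OF C(1) M] C(2) by simp
  qed
qed

text \<open>
  A lattice isomorphism preserves inclusion, hence the bottom element \<open>{}\<close> and the atoms.  All
  singletons are atoms, and a member of the lattice is the set of the atoms below it.
\<close>

lemma rel_lattice_iso_imp_point_bij:
  assumes iso: "rel_lattice_iso X Y f"
  obtains \<phi> where "bij_betw \<phi> X Y"
    and "\<And>A. A \<in> rel_lattice X \<Longrightarrow> f A = \<phi> ` A"
proof -
  have bij: "bij_betw f (rel_lattice X) (rel_lattice Y)"
    and meet: "\<And>A B. A \<in> rel_lattice X \<Longrightarrow> B \<in> rel_lattice X \<Longrightarrow> f (A \<inter> B) = f A \<inter> f B"
    using iso by (auto simp: rel_lattice_iso_def rel_meet_def)
  have fin: "f A \<in> rel_lattice Y" if "A \<in> rel_lattice X" for A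
    using bij that by (auto simp: bij_betw_def)
  have surj: "\<exists>A\<in>rel_lattice X. f A = D" if "D \<in> rel_lattice Y" for D
    using that by (metis bij bij_betw_imp_surj_on image_iff)
  have inj: "A = B" if "A \<in> rel_lattice X" "B \<in> rel_lattice X" "f A = f B" for A B
    using bij that by (auto simp: bij_betw_def inj_on_def)
  have ord: "f A \<subseteq> f B \<longleftrightarrow> A \<subseteq> B" if "A \<in> rel_lattice X" "B \<in> rel_lattice X" for A B
    using meet[OF that] inj[of "A \<inter> B" A] that rel_meet_closed[OF that]
    by (metis inf.absorb_iff1 rel_meet_def)
  have empty: "f {} = {}"
  proof -
    obtain A where "A \<in> rel_lattice X" "f A = {}"
      using surj[OF empty_in_rel_lattice] by blast
    then show ?thesis
      using ord[OF empty_in_rel_lattice, of A] by auto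
  qed
  have atom: "\<exists>y\<in>Y. f {x} = {y}" if x: "x \<in> X" for x
  proof -
    note sx = singleton_in_rel_lattice[OF x]
    have "f {x} \<noteq> {}"
      using inj[OF sx empty_in_rel_lattice] empty by auto
    then obtain y where y: "y \<in> f {x}" by blast
    then have "y \<in> Y" using rel_lattice_subset[OF fin[OF sx]] by blast
    then obtain B where B: "B \<in> rel_lattice X" "f B = {y}"
      using surj[OF singleton_in_rel_lattice] by blast
    then have "B \<subseteq> {x}" using ord[OF B(1) sx] y by simp
    moreover have "B \<noteq> {}" using B empty by auto
    ultimately have "B = {x}" by blast
    then show ?thesis using B \<open>y \<in> Y\<close> by blast
  qed
  then obtain \<phi> where \<phi>: "\<And>x. x \<in> X \<Longrightarrow> \<phi> x \<in> Y \<and> f {x} = {\<phi> x}"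
    by metis
  have mem: "\<phi> x \<in> f A \<longleftrightarrow> x \<in> A" if "x \<in> X" "A \<in> rel_lattice X" for x A
    using ord[OF singleton_in_rel_lattice[OF that(1)] that(2)] \<phi>[OF that(1)] by simp
  have onto: "\<exists>x\<in>X. \<phi> x = y" if y: "y \<in> Y" for y
  proof -
    obtain B where B: "B \<in> rel_lattice X" "f B = {y}"
      using surj[OF singleton_in_rel_lattice[OF y]] by blast
    then obtain x where "x \<in> B" using empty by fastforce
    then have "x \<in> X" "\<phi> x \<in> f B" using rel_lattice_subset[OF B(1)] mem B(1) by blast+
    then show ?thesis using B by auto
  qed
  have "inj_on \<phi> X"
    using \<phi> inj singleton_in_rel_lattice by (metis inj_onI singleton_inject)
  moreover have "\<phi> ` X = Y"
    using \<phi> onto by blast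
  ultimately have "bij_betw \<phi> X Y"
    by (simp add: bij_betw_def)
  moreover have "f A = \<phi> ` A" if A: "A \<in> rel_lattice X" for A
    using mem[OF _ A] rel_lattice_subset[OF A] rel_lattice_subset[OF fin[OF A]] onto
    by blast
  ultimately show ?thesis by (rule that)
qed

section \<open>The upper bound\<close>

text \<open>
  The composition of one labelling with the inverse of the other takes one family to the other,
  and the images under a bijection are ordered like the sets themselves.
\<close>

lemma same_code_imp_config_rel:
  assumes g: "bij_betw g X {..<n::nat}" and h: "bij_betw h Y {..<n}"
    and eq: "(`) g ` rel_lattice X = (`) h ` rel_lattice Y"
  shows "(X, Y) \<in> config_rel"
proof -
  define k where "k = inv_into Y h"
  define f where "f A = k ` g ` A" for A
  have inj_g: "inj_on g X" and inj_h: "inj_on h Y"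
    using g h by (auto simp: bij_betw_def)
  have k: "bij_betw k {..<n} Y"
    unfolding k_def by (rule bij_betw_inv_into[OF h])
  have inj_k: "inj_on k {..<n}" using k by (simp add: bij_betw_def)
  have gn: "g ` A \<subseteq> {..<n}" if "A \<in> rel_lattice X" for A
    using g rel_lattice_subset[OF that] by (auto simp: bij_betw_def)
  have kh: "k ` h ` B = B" if "B \<in> rel_lattice Y" for B
    unfolding k_def using inj_h rel_lattice_subset[OF that] by (simp add: inv_into_image_cancel)
  have ord: "f A \<subseteq> f B \<longleftrightarrow> A \<subseteq> B" if "A \<in> rel_lattice X" "B \<in> rel_lattice X" for A B
    unfolding f_def
    using inj_on_image_subset_iff[OF inj_k gn[OF that(1)] gn[OF that(2)]]
      inj_on_image_subset_iff[OF inj_g rel_lattice_subset[OF that(1)] rel_lattice_subset[OF that(2)]]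
    by simp
  have "inj_on f (rel_lattice X)"
    using ord by (metis inj_onI order_refl subset_antisym)
  moreover have "f ` rel_lattice X = rel_lattice Y"
  proof -
    have "f ` rel_lattice X = (`) k ` (`) g ` rel_lattice X"
      by (simp add: f_def image_image)
    also have "\<dots> = (`) k ` (`) h ` rel_lattice Y" by (simp only: eq)
    also have "\<dots> = (\<lambda>B. k ` h ` B) ` rel_lattice Y" by (simp add: image_image)
    also have "\<dots> = rel_lattice Y" using kh by simp
    finally show ?thesis .
  qed
  ultimately have "rel_lattice_iso X Y f"
    using ord by (intro order_iso_imp_rel_lattice_iso) (auto simp: bij_betw_def)
  then show ?thesis by (auto simp: config_rel_def)
qed

text \<open>
  Equal labelled families come from equivalent sets, so the family of one representative determines
  the whole configuration.
\<close>

lemma configurations_finite_card: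
  shows "finite (configurations n)" "card (configurations n) \<le> 2 ^ 2 ^ n"
proof -
  define M where "M = {X :: plane set. finite X \<and> card X = n}"
  define lab where "lab X = (SOME g. bij_betw g X {..<n})" for X :: "plane set"
  define code where "code X = (`) (lab X) ` rel_lattice X" for X
  define G where "G c = config_rel `` {SOME X. X \<in> M \<and> code X = c}" for c
  have lab: "bij_betw (lab X) X {..<n}" if "X \<in> M" for X
  proof -
    have "\<exists>g. bij_betw g X {..<n}"
      using that ex_bij_betw_finite_nat[of X] by (simp add: M_def atLeast0LessThan)
    then show ?thesis unfolding lab_def by (rule someI_ex)
  qed
  have cover: "configurations n \<subseteq> G ` Pow (Pow {..<n})"
  proof
    fix C assume "C \<in> configurations n"
    then obtain X where X: "X \<in> M" "C = config_rel `` {X}"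
      by (auto simp: configurations_def M_def quotient_def)
    define Y where "Y = (SOME Y. Y \<in> M \<and> code Y = code X)"
    have Y: "Y \<in> M \<and> code Y = code X"
      unfolding Y_def by (rule someI[of _ X]) (simp add: X)
    have "(X, Y) \<in> config_rel"
      using Y X same_code_imp_config_rel[OF lab lab, of X Y] by (simp add: code_def)
    then have "C = G (code X)"
      unfolding G_def X(2) Y_def[symmetric] by (rule equiv_class_eq[OF equiv_config_rel])
    moreover have "code X \<in> Pow (Pow {..<n})"
      using lab[OF X(1)] rel_lattice_subset by (fastforce simp: code_def bij_betw_def)
    ultimately show "C \<in> G ` Pow (Pow {..<n})" by blast
  qed
  have fin: "finite (Pow (Pow {..<n}))" by simp
  show "finite (configurations n)"
    using cover fin by (meson finite_imageI finite_subset)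
  show "card (configurations n) \<le> 2 ^ 2 ^ n"
    using surj_card_le[OF fin cover] by (simp add: card_Pow)
qed

section \<open>Segments as invariants\<close>

definition seg :: "plane set \<Rightarrow> plane \<Rightarrow> plane \<Rightarrow> plane set" where
  "seg X x y = closed_segment x y \<inter> X"

lemma seg_commute: "seg X x y = seg X y x"
  by (simp add: seg_def closed_segment_commute)

text \<open>
  For the fans below these are the extreme points of the convex hull.  Extremality is phrased by
  segments between two points because these segments are preserved by lattice isomorphisms.
\<close>

definition tip :: "plane set \<Rightarrow> plane \<Rightarrow> bool" where
  "tip X x \<longleftrightarrow> x \<in> X \<and> (\<forall>y\<in>X. \<forall>z\<in>X. x \<in> seg X y z \<longrightarrow> x = y \<or> x = z)"

text \<open>
  The data that can be read off from all ways of choosing three corners \<open>a\<close>, \<open>b\<close>, \<open>c\<close> whose sides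
  carry the numbers of points that the sides of a fan carry: a point on the base \<open>a b\<close> is recorded
  by its rank from \<open>a\<close>, provided that its ray from the apex \<open>c\<close> carries a third point.  The set of
  all readings does not depend on a choice of corners, which is what makes it an invariant.
\<close>

definition readings :: "plane set \<Rightarrow> nat set set" where
  "readings X = {{card (seg X a x) |x. x \<in> seg X a b \<and> card (seg X c x) = 3} |a b c.
     tip X a \<and> tip X b \<and> tip X c \<and> card (seg X a b) \<ge> 4 \<and>
     card (seg X a c) = 3 \<and> card (seg X b c) = 2}"

text \<open>
  The segment between two points is the join of the two corresponding atoms.
\<close>

lemma config_rel_imp_seg_bij:
  assumes "(X, Y) \<in> config_rel"
  obtains \<phi> where "bij_betw \<phi> X Y"
    "\<And>x y. x \<in> X \<Longrightarrow> y \<in> X \<Longrightarrow> \<phi> ` seg X x y = seg Y (\<phi> x) (\<phi> y)"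
proof -
  obtain f where f: "rel_lattice_iso X Y f"
    using assms by (auto simp: config_rel_def)
  obtain \<phi> where \<phi>: "bij_betw \<phi> X Y" "\<And>A. A \<in> rel_lattice X \<Longrightarrow> f A = \<phi> ` A"
    using rel_lattice_iso_imp_point_bij[OF f] by blast
  have join: "rel_join Z {x} {y} = seg Z x y" for Z x y
    by (simp add: rel_join_def Rch_def seg_def segment_convex_hull insert_commute)
  have "\<phi> ` seg X x y = seg Y (\<phi> x) (\<phi> y)" if "x \<in> X" "y \<in> X" for x y
  proof -
    note s = singleton_in_rel_lattice[OF that(1)] singleton_in_rel_lattice[OF that(2)]
    have "\<phi> ` seg X x y = f (rel_join X {x} {y})"
      using \<phi>(2)[OF rel_join_closed[OF s]] by (simp add: join)
    also have "\<dots> = rel_join Y (f {x}) (f {y})"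
      using f s by (simp add: rel_lattice_iso_def)
    also have "\<dots> = seg Y (\<phi> x) (\<phi> y)"
      using \<phi>(2)[OF s(1)] \<phi>(2)[OF s(2)] by (simp add: join)
    finally show ?thesis .
  qed
  with \<phi>(1) show ?thesis by (rule that)
qed

lemma config_rel_imp_readings_subset:
  assumes "(X, Y) \<in> config_rel"
  shows "readings X \<subseteq> readings Y"
proof
  obtain \<phi> where bij: "bij_betw \<phi> X Y"
    and seg: "\<And>x y. x \<in> X \<Longrightarrow> y \<in> X \<Longrightarrow> \<phi> ` seg X x y = seg Y (\<phi> x) (\<phi> y)"
    using config_rel_imp_seg_bij[OF assms] by blast
  have inj: "inj_on \<phi> X" and im: "\<phi> ` X = Y"
    using bij by (auto simp: bij_betw_def)
  have sub: "seg X x y \<subseteq> X" for x y by (auto simp: seg_def)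
  have card: "card (seg Y (\<phi> x) (\<phi> y)) = card (seg X x y)" if "x \<in> X" "y \<in> X" for x y
    using card_image[OF inj_on_subset[OF inj sub]] seg[OF that] by metis
  have mem: "\<phi> z \<in> seg Y (\<phi> x) (\<phi> y) \<longleftrightarrow> z \<in> seg X x y"
    if "x \<in> X" "y \<in> X" "z \<in> X" for x y z
    using seg[OF that(1,2)] inj_on_image_mem_iff[OF inj that(3) sub] by metis
  have tip: "tip Y (\<phi> x)" if "tip X x" for x
    unfolding tip_def
  proof (intro conjI ballI impI)
    show "\<phi> x \<in> Y" using that im by (auto simp: tip_def)
    fix y' z' assume *: "y' \<in> Y" "z' \<in> Y" "\<phi> x \<in> seg Y y' z'"
    then obtain y z where yz: "y \<in> X" "z \<in> X" "y' = \<phi> y" "z' = \<phi> z"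
      using im by blast
    then have "x \<in> seg X y z" using * mem[of y z x] that by (simp add: tip_def)
    then show "\<phi> x = y' \<or> \<phi> x = z'" using that yz by (auto simp: tip_def)
  qed
  fix T assume "T \<in> readings X"
  then obtain a b c where abc: "tip X a" "tip X b" "tip X c" "card (seg X a b) \<ge> 4"
      "card (seg X a c) = 3" "card (seg X b c) = 2"
    and T: "T = {card (seg X a x) |x. x \<in> seg X a b \<and> card (seg X c x) = 3}"
    unfolding readings_def by blast
  have X: "a \<in> X" "b \<in> X" "c \<in> X" using abc by (auto simp: tip_def)
  have "T = {card (seg Y (\<phi> a) y) |y. y \<in> seg Y (\<phi> a) (\<phi> b) \<and> card (seg Y (\<phi> c) y) = 3}"
  proof -
    have row: "(t = card (seg Y (\<phi> a) (\<phi> x)) \<and> x \<in> seg X a b \<and> card (seg Y (\<phi> c) (\<phi> x)) = 3)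
        \<longleftrightarrow> (t = card (seg X a x) \<and> x \<in> seg X a b \<and> card (seg X c x) = 3)" for t x
    proof (cases "x \<in> seg X a b")
      case True
      then have "x \<in> X" using sub by blast
      then show ?thesis by (simp add: card X)
    qed simp
    have ab: "seg Y (\<phi> a) (\<phi> b) = \<phi> ` seg X a b" using seg X by simp
    have "{card (seg Y (\<phi> a) y) |y. y \<in> seg Y (\<phi> a) (\<phi> b) \<and> card (seg Y (\<phi> c) y) = 3}
      = {card (seg Y (\<phi> a) (\<phi> x)) |x. x \<in> seg X a b \<and> card (seg Y (\<phi> c) (\<phi> x)) = 3}"
      unfolding ab by blast
    also have "\<dots> = T"
      unfolding T by (simp only: row)
    finally show ?thesis by simp
  qed
  moreover have "tip Y (\<phi> a) \<and> tip Y (\<phi> b) \<and> tip Y (\<phi> c) \<and> card (seg Y (\<phi> a) (\<phi> b)) \<ge> 4 \<and>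
     card (seg Y (\<phi> a) (\<phi> c)) = 3 \<and> card (seg Y (\<phi> b) (\<phi> c)) = 2"
    using abc by (simp add: tip card X)
  ultimately show "T \<in> readings Y"
    unfolding readings_def by blast
qed

section \<open>Fans\<close>

definition pt :: "real \<Rightarrow> real \<Rightarrow> plane" where
  "pt x y = vector [x, y]"

lemma pt_eq_iff [simp]: "pt a b = pt c d \<longleftrightarrow> a = c \<and> b = d"
  by (auto simp: pt_def vec_eq_iff forall_2)

lemma pt_in_segment:
  "pt a b \<in> closed_segment (pt c d) (pt e f) \<longleftrightarrow>
     (\<exists>u. 0 \<le> u \<and> u \<le> 1 \<and> a = (1 - u) * c + u * e \<and> b = (1 - u) * d + u * f)"
  by (auto simp: closed_segment_def pt_def vec_eq_iff forall_2)

text \<open>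
  The coordinates put the apex at height 2, the base line at height 0 and all midpoints of the rays
  at height 1, so that a segment from the apex meets each of the levels once.
\<close>

definition fan :: "nat \<Rightarrow> nat set \<Rightarrow> plane set" where
  "fan m S = insert (pt 0 2) ((\<lambda>i. pt (2 * real i) 0) ` {..m} \<union> (\<lambda>i. pt (real i) 1) ` S)"

lemma fan_finite: "finite S \<Longrightarrow> finite (fan m S)"
  by (simp add: fan_def)

lemma fan_card:
  assumes "finite S"
  shows "card (fan m S) = m + 2 + card S"
proof -
  have "card ((\<lambda>i. pt (2 * real i) 0) ` {..m} \<union> (\<lambda>i. pt (real i) 1) ` S) = Suc m + card S"
    using assms by (subst card_Un_disjoint) (auto simp: card_image inj_on_def)
  moreover have "pt 0 2 \<notin> (\<lambda>i. pt (2 * real i) 0) ` {..m} \<union> (\<lambda>i. pt (real i) 1) ` S"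
    by auto
  ultimately show ?thesis
    unfolding fan_def using assms by simp
qed

lemma fan_base_segment:
  assumes "i \<le> m"
  shows "seg (fan m S) (pt 0 0) (pt (2 * real i) 0) = (\<lambda>k. pt (2 * real k) 0) ` {..i}"
proof
  show "seg (fan m S) (pt 0 0) (pt (2 * real i) 0) \<subseteq> (\<lambda>k. pt (2 * real k) 0) ` {..i}"
  proof
    fix z assume z: "z \<in> seg (fan m S) (pt 0 0) (pt (2 * real i) 0)"
    then have "z \<in> closed_segment (pt 0 0) (pt (2 * real i) 0)" by (simp add: seg_def)
    then obtain u where u: "0 \<le> u" "u \<le> 1" "z = pt (u * (2 * real i)) 0"
      by (auto simp: closed_segment_def pt_def vec_eq_iff forall_2)
    obtain k where k: "z = pt (2 * real k) 0"
      using z u by (auto simp: seg_def fan_def)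
    have "real k = u * real i" using u k by simp
    then have "real k \<le> real i" using u by (simp add: mult_left_le_one_le)
    then show "z \<in> (\<lambda>k. pt (2 * real k) 0) ` {..i}" using k by auto
  qed
  have "pt (2 * real k) 0 \<in> closed_segment (pt 0 0) (pt (2 * real i) 0)" if "k \<le> i" for k
    unfolding pt_in_segment using that
    by (intro exI[of _ "real k / real i"]) (auto simp: divide_simps)
  then show "(\<lambda>k. pt (2 * real k) 0) ` {..i} \<subseteq> seg (fan m S) (pt 0 0) (pt (2 * real i) 0)"
    using assms by (auto simp: seg_def fan_def)
qed

lemma fan_base_segment_card:
  "i \<le> m \<Longrightarrow> card (seg (fan m S) (pt 0 0) (pt (2 * real i) 0)) = Suc i"
  by (simp add: fan_base_segment card_image inj_on_def)

lemma fan_ray_segment: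
  assumes "i \<le> m"
  shows "seg (fan m S) (pt 0 2) (pt (2 * real i) 0) =
    {pt 0 2, pt (2 * real i) 0} \<union> (if i \<in> S then {pt (real i) 1} else {})"
proof
  show "seg (fan m S) (pt 0 2) (pt (2 * real i) 0) \<subseteq>
    {pt 0 2, pt (2 * real i) 0} \<union> (if i \<in> S then {pt (real i) 1} else {})"
  proof
    fix z assume z: "z \<in> seg (fan m S) (pt 0 2) (pt (2 * real i) 0)"
    then have "z \<in> closed_segment (pt 0 2) (pt (2 * real i) 0)" by (simp add: seg_def)
    then obtain u where u: "z = pt (u * (2 * real i)) (2 - 2 * u)"
      by (auto simp: closed_segment_def pt_def vec_eq_iff forall_2)
    consider "z = pt 0 2" | k where "z = pt (2 * real k) 0" | k where "k \<in> S" "z = pt (real k) 1"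
      using z by (auto simp: seg_def fan_def)
    then show "z \<in> {pt 0 2, pt (2 * real i) 0} \<union> (if i \<in> S then {pt (real i) 1} else {})"
    proof cases
      case 2
      then have "u = 1" using u by simp
      then show ?thesis using u by simp
    next
      case 3
      then have half: "u = 1 / 2" using u by simp
      have "u * (2 * real i) = real k" using u 3 by simp
      then have "k = i" unfolding half by simp
      then show ?thesis using 3 by simp
    qed simp
  qed
  have "pt (real i) 1 \<in> closed_segment (pt 0 2) (pt (2 * real i) 0)"
    unfolding pt_in_segment by (intro exI[of _ "1/2"]) auto
  then show "{pt 0 2, pt (2 * real i) 0} \<union> (if i \<in> S then {pt (real i) 1} else {})
      \<subseteq> seg (fan m S) (pt 0 2) (pt (2 * real i) 0)"
    using assms by (auto simp: seg_def fan_def)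
qed

lemma fan_ray_segment_card:
  "i \<le> m \<Longrightarrow> card (seg (fan m S) (pt 0 2) (pt (2 * real i) 0)) = (if i \<in> S then 3 else 2)"
  by (simp add: fan_ray_segment)

text \<open>
  A linear functional takes a value on a segment that is at most its larger value at the ends.
\<close>

lemma tip_if_unique_max:
  assumes "x \<in> X" "\<And>y. y \<in> X \<Longrightarrow> y \<noteq> x \<Longrightarrow> v \<bullet> y < v \<bullet> x"
  shows "tip X x"
  unfolding tip_def
proof (intro conjI ballI impI assms(1))
  fix y z assume yz: "y \<in> X" "z \<in> X" "x \<in> seg X y z"
  show "x = y \<or> x = z"
  proof (rule ccontr)
    assume "\<not> (x = y \<or> x = z)"
    then have lt: "v \<bullet> y < v \<bullet> x" "v \<bullet> z < v \<bullet> x" using assms yz by auto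
    obtain u where u: "0 \<le> u" "u \<le> 1" "x = (1 - u) *\<^sub>R y + u *\<^sub>R z"
      using yz by (auto simp: seg_def closed_segment_def)
    have "v \<bullet> x = (1 - u) * (v \<bullet> y) + u * (v \<bullet> z)"
      using u by (simp add: inner_right_distrib)
    also have "\<dots> < v \<bullet> x"
      using convex_bound_lt[OF lt, of "1 - u" u] u by simp
    finally show False by simp
  qed
qed

lemma inner_pt: "pt a b \<bullet> pt c d = a * c + b * d"
  by (simp add: pt_def inner_vec_def sum_2)

text \<open>
  A midpoint lies between the apex and a base point, and a base point lies between the two ends of
  the base.  The three corners are the unique maxima of \<open>y\<close>, \<open>- x - y\<close> and \<open>x + y\<close>; for the last one
  the base has to be long enough for its end to beat the apex and the midpoints.
\<close>

lemma fan_tips: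
  assumes m: "3 \<le> m" and S: "S \<subseteq> {..m}" 
  shows "tip (fan m S) x \<longleftrightarrow> x \<in> {pt 0 2, pt 0 0, pt (2 * real m) 0}"
proof
  assume t: "tip (fan m S) x"
  have "x \<in> fan m S" using t by (simp add: tip_def)
  then consider "x = pt 0 2" | i where "i \<le> m" "x = pt (2 * real i) 0"
    | i where "i \<in> S" "x = pt (real i) 1"
    by (auto simp: fan_def)
  then show "x \<in> {pt 0 2, pt 0 0, pt (2 * real m) 0}"
  proof cases
    case 2
    have "x \<in> seg (fan m S) (pt 0 0) (pt (2 * real m) 0)"
      using 2 fan_base_segment[of m m S] by auto
    moreover have "pt 0 0 \<in> fan m S" "pt (2 * real m) 0 \<in> fan m S"
      by (auto simp: fan_def image_iff)
    ultimately show ?thesis using t unfolding tip_def by blast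
  next
    case 3
    then have i: "i \<le> m" using S by auto
    have "x \<in> seg (fan m S) (pt 0 2) (pt (2 * real i) 0)"
      using 3 fan_ray_segment[OF i, of S] by auto
    moreover have "pt 0 2 \<in> fan m S" "pt (2 * real i) 0 \<in> fan m S"
      using i by (auto simp: fan_def)
    ultimately show ?thesis using t 3 unfolding tip_def by fastforce
  qed simp
next
  assume "x \<in> {pt 0 2, pt 0 0, pt (2 * real m) 0}"
  then consider "x = pt 0 2" | "x = pt 0 0" | "x = pt (2 * real m) 0" by blast
  then show "tip (fan m S) x"
  proof cases
    case 1
    show ?thesis
      by (rule tip_if_unique_max[where v = "pt 0 1"]) (auto simp: 1 fan_def inner_pt)
  next
    case 2
    show ?thesis
      by (rule tip_if_unique_max[where v = "pt (-1) (-1)"]) (auto simp: 2 fan_def inner_pt image_iff)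
  next
    case 3
    have "real i + 1 < 2 * real m" if "i \<in> S" for i
      using that S m by force
    then show ?thesis
      using m by (intro tip_if_unique_max[where v = "pt 1 1"]) (auto simp: 3 fan_def inner_pt)
  qed
qed

text \<open>
  A triangle with three different side lengths has no symmetry.  The bound on \<open>d x x\<close> excludes
  degenerate triples with a repeated corner.
\<close>

lemma scalene_labels_unique:
  fixes d :: "'a \<Rightarrow> 'a \<Rightarrow> nat"
  assumes sym: "\<And>x y. d x y = d y x" and refl: "\<And>x. d x x \<le> 1"
    and d: "4 \<le> d A B" "d A C = 3" "d B C = 2"
  shows "(a \<in> {A, B, C} \<and> b \<in> {A, B, C} \<and> c \<in> {A, B, C} \<and> 4 \<le> d a b \<and> d a c = 3 \<and> d b c = 2)
    \<longleftrightarrow> (a = A \<and> b = B \<and> c = C)"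
proof -
  have "4 \<le> d B A" "d C A = 3" "d C B = 2"
    using d sym[of A B] sym[of A C] sym[of B C] by auto
  with d refl[of A] refl[of B] refl[of C] show ?thesis by auto
qed

text \<open>
  The ray to \<open>p\<^sub>0\<close> has a midpoint and the ray to \<open>p\<^sub>m\<close> has none, which breaks the reflection of the base
  line.  The successor appears because the segment from \<open>p\<^sub>0\<close> to \<open>p\<^sub>i\<close> carries \<open>i + 1\<close> base points.
\<close>

lemma fan_readings:
  assumes m: "3 \<le> m" and S: "S \<subseteq> {..<m}" "0 \<in> S"
  shows "readings (fan m S) = {Suc ` S}"
proof -
  let ?X = "fan m S" and ?a = "pt 0 0" and ?b = "pt (2 * real m) 0" and ?c = "pt 0 2"
  have S': "S \<subseteq> {..m}" "m \<notin> S" using S by auto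
  have ab: "card (seg ?X ?a ?b) = Suc m"
    by (rule fan_base_segment_card) simp
  have ca: "card (seg ?X ?c ?a) = 3"
    using fan_ray_segment_card[of 0 m S] S by simp
  have cb: "card (seg ?X ?c ?b) = 2"
    using fan_ray_segment_card[of m m S] S' by simp
  have seg_refl: "card (seg ?X x x) \<le> 1" for x
    using card_mono[of "{x}" "seg ?X x x"] by (auto simp: seg_def)
  have d_sym: "card (seg ?X x y) = card (seg ?X y x)" for x y
    by (simp only: seg_commute)
  have d: "4 \<le> card (seg ?X ?a ?b)" "card (seg ?X ?a ?c) = 3" "card (seg ?X ?b ?c) = 2"
    using ab ca cb m d_sym by simp_all
  have unique: "tip ?X a \<and> tip ?X b \<and> tip ?X c \<and> card (seg ?X a b) \<ge> 4 \<and>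
     card (seg ?X a c) = 3 \<and> card (seg ?X b c) = 2 \<longleftrightarrow> a = ?a \<and> b = ?b \<and> c = ?c" for a b c
    unfolding fan_tips[OF m S'(1)]
    using scalene_labels_unique[OF d_sym seg_refl d, of a b c] by blast
  have row: "(t = card (seg ?X ?a (pt (2 * real i) 0)) \<and> i \<le> m \<and>
      card (seg ?X ?c (pt (2 * real i) 0)) = 3) \<longleftrightarrow> (t = Suc i \<and> i \<le> m \<and> i \<in> S)" for t i
    by (cases "i \<le> m") (simp_all add: fan_base_segment_card fan_ray_segment_card)
  have "{card (seg ?X ?a x) |x. x \<in> seg ?X ?a ?b \<and> card (seg ?X ?c x) = 3}
    = {card (seg ?X ?a (pt (2 * real i) 0)) |i. i \<le> m \<and> card (seg ?X ?c (pt (2 * real i) 0)) = 3}"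
    by (subst fan_base_segment) auto
  also have "\<dots> = {Suc i |i. i \<le> m \<and> i \<in> S}"
    by (simp only: row)
  also have "\<dots> = Suc ` S" using S' by auto
  finally show ?thesis
    unfolding readings_def unique by simp
qed

section \<open>The lower bound\<close>

text \<open>
  These sets index the fans of a given size: enlarging the set by one element has to be paid for
  by a shorter base.  Sorting them by cardinality gives a shallow diagonal of Pascal's triangle.
\<close>

lemma card_sparse_sets:
  "card {S. finite S \<and> card S \<le> N \<and> S \<subseteq> {1..N - card S}} = fib (Suc N)"
proof -
  have "{S. finite S \<and> card S \<le> N \<and> S \<subseteq> {1..N - card S}}
    = (\<Union>k\<in>{0..N}. {S. S \<subseteq> {1..N - k} \<and> card S = k})"
    by (auto intro: finite_subset)
  also have "card \<dots> = (\<Sum>k=0..N. card {S. S \<subseteq> {1..N - k} \<and> card S = k})"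
    by (subst card_UN_disjoint) auto
  also have "\<dots> = (\<Sum>k=0..N. (N - k) choose k)"
    by (simp add: n_subsets)
  also have "\<dots> = fib (Suc N)"
    by (simp add: ne_diagonal_fib)
  finally show ?thesis .
qed

text \<open>
  The fan belonging to \<open>S\<close> has midpoints at the indices \<open>insert 0 S\<close>.  Of the \<open>n\<close> points, four are
  always spent on the apex, both ends of the base and the midpoint on the ray to \<open>p\<^sub>0\<close>; the other
  \<open>N = n - 4\<close> are \<open>card S\<close> midpoints and \<open>N - card S\<close> interior points of the base.
\<close>

lemma fib_le_num_configs:
  assumes "7 \<le> n"
  shows "fib (n - 3) \<le> num_configs n"
proof -
  define N where "N = n - 4"
  define \<S> where "\<S> = {S. finite S \<and> card S \<le> N \<and> S \<subseteq> {1..N - card S}}"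
  define X where "X S = fan (Suc (N - card S)) (insert 0 S)" for S
  have reading: "readings (X S) = {Suc ` insert 0 S}" if "S \<in> \<S>" for S
  proof -
    \<comment> \<open>\<open>S\<close> fits into the interior of the base, so at least half of the \<open>N \<ge> 3\<close> points lie there.\<close>
    have "card S \<le> N - card S"
      using that card_mono[of "{1..N - card S}" S] by (simp add: \<S>_def)
    then have "3 \<le> Suc (N - card S)" using assms by (simp add: N_def)
    then show ?thesis
      unfolding X_def using that by (intro fan_readings) (auto simp: \<S>_def)
  qed
  have size: "finite (X S) \<and> card (X S) = n" if "S \<in> \<S>" for S
  proof -
    have "0 \<notin> S" "finite S" "card S \<le> N" using that by (auto simp: \<S>_def)
    then show ?thesis
      unfolding X_def using assms by (simp add: fan_card fan_finite N_def)
  qed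
  have "inj_on (\<lambda>S. config_rel `` {X S}) \<S>"
  proof
    fix S T assume ST: "S \<in> \<S>" "T \<in> \<S>" and "config_rel `` {X S} = config_rel `` {X T}"
    then have "(X S, X T) \<in> config_rel"
      using eq_equiv_class[OF _ equiv_config_rel] by blast
    then have "Suc ` insert 0 S = Suc ` insert 0 T"
      using config_rel_imp_readings_subset[of "X S" "X T"] reading[OF ST(1)] reading[OF ST(2)]
      by simp
    then have "insert 0 S = insert 0 T" by (simp only: inj_image_eq_iff[OF inj_Suc])
    moreover have "0 \<notin> S" "0 \<notin> T" using ST by (auto simp: \<S>_def)
    ultimately show "S = T" by (meson insert_ident)
  qed
  moreover have "(\<lambda>S. config_rel `` {X S}) ` \<S> \<subseteq> configurations n"
    unfolding configurations_def using size by (intro image_subsetI quotientI) simp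
  ultimately have "card \<S> \<le> num_configs n"
    unfolding num_configs_def using configurations_finite_card(1) by (rule card_inj_on_le)
  moreover have "Suc N = n - 3" using assms by (simp add: N_def)
  ultimately show ?thesis using card_sparse_sets[of N] by (simp add: \<S>_def)
qed

text \<open>
  The constant stays below the golden ratio, and the shift by 4 is large enough for both base cases.
\<close>

lemma fib_ge_power: "(1.58::real) ^ Suc k \<le> real (fib (k + 4))"
proof (induction k rule: fib.induct)
  case 1
  show ?case by (simp add: eval_nat_numeral)
next
  case 2
  show ?case by (simp add: eval_nat_numeral)
next
  case (3 k)
  have "(1.58::real) ^ Suc (Suc (Suc k)) = 1.58 ^ Suc k * 1.58\<^sup>2"
    by (simp add: power2_eq_square)
  also have "\<dots> \<le> 1.58 ^ Suc k * (1.58 + 1)"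
    by (intro mult_left_mono) (auto simp: power2_eq_square)
  also have "\<dots> = 1.58 ^ Suc (Suc k) + 1.58 ^ Suc k"
    by (simp add: algebra_simps)
  also have "\<dots> \<le> real (fib (Suc k + 4)) + real (fib (k + 4))"
    by (rule add_mono[OF 3])
  also have "\<dots> = real (fib (Suc (Suc k) + 4))" 
    unfolding add_Suc fib2 by (rule of_nat_add[symmetric])
  finally show ?case .
qed

lemma num_configs_pos: "0 < num_configs n"
proof -
  have "card ((\<lambda>i. pt (real i) 0) ` {..<n}) = n"
    by (simp add: card_image inj_on_def)
  then have "config_rel `` {(\<lambda>i. pt (real i) 0) ` {..<n}} \<in> configurations n"
    unfolding configurations_def by (intro quotientI) simp
  then show ?thesis
    unfolding num_configs_def using configurations_finite_card(1) by (metis card_gt_0_iff empty_iff)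
qed

theorem theorem6:
  fixes n :: nat
  assumes "n \<ge> 1"
  shows "(1.58::real) powr (real n - 6) \<le> real (num_configs n)
       \<and> num_configs n \<le> 2 ^ (n * 2 ^ n)"
proof
  show "(1.58::real) powr (real n - 6) \<le> real (num_configs n)"
  proof (cases "n \<le> 6")
    case True
    then have "(1.58::real) powr (real n - 6) \<le> 1.58 powr 0"
      by (intro powr_mono) auto
    also have "\<dots> \<le> real (num_configs n)"
      using num_configs_pos[of n] by simp
    finally show ?thesis .
  next
    case False
    define k where "k = n - 7"
    with False have k: "n = k + 7" by simp
    have "(1.58::real) powr (real n - 6) = 1.58 powr real (Suc k)"
      by (simp add: k add.commute)
    also have "\<dots> = 1.58 ^ Suc k"
      by (rule powr_realpow) simp
    also have "\<dots> \<le> real (fib (n - 3))"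
      using fib_ge_power[of k] by (simp add: k add.commute)
    also have "\<dots> \<le> real (num_configs n)"
      using fib_le_num_configs[of n] k by simp
    finally show ?thesis .
  qed
  have "num_configs n \<le> 2 ^ 2 ^ n"
    unfolding num_configs_def by (rule configurations_finite_card(2))
  also have "\<dots> \<le> 2 ^ (n * 2 ^ n)"
    using assms by (intro power_increasing) auto
  finally show "num_configs n \<le> 2 ^ (n * 2 ^ n)" .
qed

end
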